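(* Let $X$ be a Polish space and let $K$ be a set of functions $f:X\to\mathbb{R}$, each having at most countably many points of discontinuity, such that $K$ is compact in the topology of pointwise convergence on $X$. Then $K$ is a Corson-to-one preimage of a metric space; that is, there exist a metric space $M$ and a continuous surjection $r:K\to M$ such that $r^{-1}(m)$ is a Corson compactum for every $m\in M$.
   Context: A compact space $C$ is Corson if it is homeomorphic to a compact subset $C'\subset\mathbb{R}^I$ of some power of the real line (with the product topology) such that for every $x,y\in C'$ the set $\{i\in I: x_i\neq y_i\}$ is at most countable. $K$ carries the topology of pointwise convergence, i.e. the subspace topology from $\mathbb{R}^X$. *)

theory Defs
  imports "HOL-Analysis.Analysis"
begin

text \<open>
  Spaces are represented by abstract topologies with an explicit carrier. A real function on
  the space \<open>X\<close> is an element of \<open>topspace (powertop_real (topspace X))\<close>, that is, a function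
  that is \<open>undefined\<close> outside the carrier, so that equality of functions means equality on \<open>X\<close>;
  \<open>powertop_real (topspace X)\<close> is the topology of pointwise convergence.
\<close>

text \<open>
  The index set of the power of the line is taken inside the type \<^typ>\<open>'b \<Rightarrow> real\<close>, since
  HOL cannot quantify over types within a formula. This is no restriction: coordinates that
  agree on the whole space may be identified, so the real functions on the space suffice as
  indices; see \<open>Corson_compactI\<close>.
\<close>

definition Corson_compact :: "'b topology \<Rightarrow> bool" where
  "Corson_compact C \<longleftrightarrow>
     (\<exists>(I :: ('b \<Rightarrow> real) set) C'.
        compactin (powertop_real I) C' \<and>
        (\<forall>x\<in>C'. \<forall>y\<in>C'. countable {i \<in> I. x i \<noteq> y i}) \<and>
        C homeomorphic_space (subtopology (powertop_real I) C'))"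

lemma Corson_compactI:
  fixes C :: "'b topology" and I :: "'i set"
  assumes cpt: "compactin (powertop_real I) C'"
    and cnt: "\<And>x y. x \<in> C' \<Longrightarrow> y \<in> C' \<Longrightarrow> countable {i \<in> I. x i \<noteq> y i}"
    and hom: "C homeomorphic_space (subtopology (powertop_real I) C')"
  shows "Corson_compact C"
proof -
  obtain g where g: "homeomorphic_map C (subtopology (powertop_real I) C') g"
    using hom homeomorphic_space by blast
  have sub: "C' \<subseteq> topspace (powertop_real I)"
    using cpt compactin_subset_topspace by blast
  have img: "g ` topspace C = C'"
    using homeomorphic_imp_surjective_map[OF g] sub by (simp only: topspace_subtopology_subset)
  have inj: "inj_on g (topspace C)"
    using g homeomorphic_imp_injective_map by blast
  have "continuous_map C (powertop_real I) g"
    using homeomorphic_imp_continuous_map[OF g] continuous_map_in_subtopology by blast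
  then have gi: "continuous_map C euclideanreal (\<lambda>c. g c i)" if "i \<in> I" for i
    using that by (simp add: continuous_map_componentwise)
  have cptC: "compact_space C"
    using homeomorphic_compact_space[OF hom] cpt compactin_subspace by blast
  define ev where "ev = (\<lambda>i c. g c i)"
  define J where "J = ev ` I"
  define p where "p = (\<lambda>c. \<lambda>\<phi>\<in>J. \<phi> c)"
  have contp: "continuous_map C (powertop_real J) p"
    unfolding continuous_map_componentwise
    using gi by (auto simp: p_def J_def ev_def)
  have injp: "inj_on p (topspace C)"
  proof (rule inj_onI)
    fix c d assume c: "c \<in> topspace C" and d: "d \<in> topspace C" and eq: "p c = p d"
    have "g c i = g d i" if "i \<in> I" for i
      using fun_cong[OF eq, of "ev i"] that by (simp add: p_def J_def ev_def)
    moreover have "g c \<in> extensional I" "g d \<in> extensional I"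
      using c d img sub by (auto simp: PiE_def)
    ultimately have "g c = g d" by (meson extensionalityI)
    then show "c = d" using inj c d by (meson inj_onD)
  qed
  have imgp: "p ` topspace C \<subseteq> topspace (powertop_real J)"
    using contp continuous_map_image_subset_topspace by blast
  have "homeomorphic_map C (subtopology (powertop_real J) (p ` topspace C)) p"
  proof (rule continuous_imp_homeomorphic_map)
    show "continuous_map C (subtopology (powertop_real J) (p ` topspace C)) p"
      using contp by (simp add: continuous_map_in_subtopology)
    show "Hausdorff_space (subtopology (powertop_real J) (p ` topspace C))"
      by (simp add: Hausdorff_space_subtopology Hausdorff_space_product_topology)
    show "p ` topspace C = topspace (subtopology (powertop_real J) (p ` topspace C))"
      using imgp by (simp only: topspace_subtopology_subset)
  qed (use cptC injp in auto)
  moreover have "compactin (powertop_real J) (p ` topspace C)"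
    using cptC contp image_compactin compact_space_def by blast
  moreover have "countable {\<phi> \<in> J. p c \<phi> \<noteq> p d \<phi>}"
    if "c \<in> topspace C" "d \<in> topspace C" for c d
  proof -
    have "{\<phi> \<in> J. p c \<phi> \<noteq> p d \<phi>} \<subseteq> ev ` {i \<in> I. g c i \<noteq> g d i}"
      by (auto simp: p_def J_def ev_def)
    moreover have "countable {i \<in> I. g c i \<noteq> g d i}"
      using cnt img that by blast
    ultimately show ?thesis by (meson countable_image countable_subset)
  qed
  ultimately show ?thesis
    unfolding Corson_compact_def
    by (intro exI[of _ J] exI[of _ "p ` topspace C"] conjI ballI)
       (auto intro: homeomorphic_map_imp_homeomorphic_space)
qed

text \<open>
  The metric space is carried by a subset of the type \<^typ>\<open>'b\<close> of points of \<open>T\<close>. Again this is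
  no restriction, since a surjective image of \<open>T\<close> can be copied into \<open>T\<close>; see
  \<open>Corson_to_one_preimage_of_metricI\<close>.
\<close>

definition Corson_to_one_preimage_of_metric :: "'b topology \<Rightarrow> bool" where
  "Corson_to_one_preimage_of_metric T \<longleftrightarrow>
     (\<exists>(M :: 'b metric) r.
        continuous_map T (mtopology_of M) r \<and>
        r ` topspace T = mspace M \<and>
        (\<forall>m\<in>mspace M. Corson_compact (subtopology T {x \<in> topspace T. r x = m})))"

lemma Corson_to_one_preimage_of_metricI:
  fixes T :: "'b topology" and M :: "'m metric"
  assumes cont: "continuous_map T (mtopology_of M) r"
    and surj: "r ` topspace T = mspace M"
    and fib: "\<And>m. m \<in> mspace M \<Longrightarrow> Corson_compact (subtopology T {x \<in> topspace T. r x = m})"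
  shows "Corson_to_one_preimage_of_metric T"
proof -
  define s where "s = inv_into (topspace T) r"
  have rs: "r (s m) = m" if "m \<in> mspace M" for m
    using that surj by (simp add: s_def f_inv_into_f)
  define N where "N = metric (s ` mspace M, \<lambda>x y. mdist M (r x) (r y))"
  have "Metric_space (s ` mspace M) (\<lambda>x y. mdist M (r x) (r y))"
    by unfold_locales (auto simp: rs mdist_commute mdist_triangle)
  then have N: "mspace N = s ` mspace M" "mdist N = (\<lambda>x y. mdist M (r x) (r y))"
    by (simp_all add: N_def Metric_space.mspace_metric Metric_space.mdist_metric)
  have "Lipschitz_continuous_map M N s"
    unfolding Lipschitz_continuous_map_def by (auto simp: N rs intro!: exI[of _ 1])
  then have "continuous_map (mtopology_of M) (mtopology_of N) s"
    by (simp add: Lipschitz_continuous_imp_continuous_map)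
  then have "continuous_map T (mtopology_of N) (s \<circ> r)"
    using cont continuous_map_compose by blast
  moreover have "(s \<circ> r) ` topspace T = mspace N"
    by (metis N(1) image_comp surj)
  moreover have "Corson_compact (subtopology T {x \<in> topspace T. (s \<circ> r) x = n})"
    if n: "n \<in> mspace N" for n
  proof -
    obtain m where m: "m \<in> mspace M" "n = s m" using n N by auto
    have "{x \<in> topspace T. (s \<circ> r) x = n} = {x \<in> topspace T. r x = m}"
    proof (intro Collect_cong conj_cong refl)
      fix x assume "x \<in> topspace T"
      then have "r x \<in> mspace M" using surj by blast
      then show "((s \<circ> r) x = n) = (r x = m)"
        using m rs[of m] rs[of "r x"] by auto
    qed
    then show ?thesis using fib m by simp
  qed
  ultimately show ?thesis
    unfolding Corson_to_one_preimage_of_metric_def by blast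
qed

end

theory Submission
  imports Defs
begin

text \<open>
  Let \<open>r\<close> restrict every function in \<open>K\<close> to a fixed countable dense set \<open>D \<subseteq> X\<close>. Its image
  lies in a countable power of the line, which is metrizable. Two functions in the same fibre
  agree on the dense set \<open>D\<close>, hence at every point at which both are continuous; by hypothesis
  all but countably many points are of this kind. So each fibre, sitting in the power of the
  line indexed by \<open>X\<close>, satisfies the countability condition of a Corson compactum in its
  own coordinates, and it is compact because it is closed in \<open>K\<close>.
\<close>

text \<open>
  Separate the two values by disjoint open sets: by continuity, their preimages contain a common
  neighbourhood of \<open>x\<close>, which meets \<open>D\<close> in a point where \<open>f\<close> and \<open>g\<close> would have to differ.
  Continuity is used at the single point \<open>x\<close>, so the argument survives discontinuities elsewhere.
\<close>

lemma topcontinuous_at_eq_in_closure_of: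
  assumes x: "x \<in> X closure_of D"
    and f: "topcontinuous_at X Y f x" and g: "topcontinuous_at X Y g x"
    and haus: "Hausdorff_space Y"
    and eq: "\<And>d. d \<in> D \<Longrightarrow> f d = g d"
  shows "f x = g x"
proof (rule ccontr)
  assume "f x \<noteq> g x"
  moreover have "f x \<in> topspace Y" "g x \<in> topspace Y"
    using f g by (auto simp: topcontinuous_at_def)
  ultimately obtain U V where UV: "openin Y U" "openin Y V" "f x \<in> U" "g x \<in> V" "disjnt U V"
    using haus unfolding Hausdorff_space_def by meson
  obtain A where A: "openin X A" "x \<in> A" "\<And>y. y \<in> A \<Longrightarrow> f y \<in> U"
    using f UV unfolding topcontinuous_at_def by meson
  obtain B where B: "openin X B" "x \<in> B" "\<And>y. y \<in> B \<Longrightarrow> g y \<in> V"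
    using g UV unfolding topcontinuous_at_def by meson
  obtain d where "d \<in> D" "d \<in> A \<inter> B"
    using x A B unfolding in_closure_of by (meson IntI openin_Int)
  then show False
    using A(3)[of d] B(3)[of d] UV(5) eq[of d] by (auto simp: disjnt_iff)
qed

text \<open>
  Restricting the coordinates of a power of the line to a countable set lands in a metrizable
  space, so it is enough to control the fibres of such a restriction. Each fibre is closed in the compact
  set \<open>K\<close>, and the given coordinates \<open>I\<close> witness that it is Corson.
\<close>

lemma Corson_to_one_preimage_of_metric_countable_coordinates:
  assumes K: "compactin (powertop_real I) K"
    and D: "countable D" "D \<subseteq> I"
    and cnt: "\<And>f g. \<lbrakk>f \<in> K; g \<in> K; \<And>d. d \<in> D \<Longrightarrow> f d = g d\<rbrakk>
      \<Longrightarrow> countable {i \<in> I. f i \<noteq> g i}"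
  shows "Corson_to_one_preimage_of_metric (subtopology (powertop_real I) K)"
proof -
  let ?T = "subtopology (powertop_real I) K"
  define r :: "('a \<Rightarrow> real) \<Rightarrow> 'a \<Rightarrow> real" where "r = (\<lambda>f. restrict f D)"
  have topT: "topspace ?T = K"
    by (rule topspace_subtopology_subset[OF compactin_subset_topspace[OF K]])
  have cont: "continuous_map ?T (powertop_real D) r"
    unfolding continuous_map_componentwise
  proof (intro conjI ballI)
    show "r ` topspace ?T \<subseteq> extensional D"
      by (auto simp: r_def)
    fix d assume "d \<in> D"
    then have rd: "(\<lambda>f. r f d) = (\<lambda>f. f d)" and "d \<in> I"
      using D(2) by (auto simp: r_def)
    show "continuous_map ?T euclideanreal (\<lambda>f. r f d)"
      unfolding rd using \<open>d \<in> I\<close>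
      by (intro continuous_map_from_subtopology continuous_map_product_projection)
  qed
  have "metrizable_space (subtopology (powertop_real D) (r ` K))"
  proof (rule metrizable_space_subtopology)
    have "countable {i \<in> D. \<nexists>a. topspace euclideanreal \<subseteq> {a}}"
      using D(1) by (rule countable_subset[rotated]) blast
    then show "metrizable_space (powertop_real D)"
      by (simp add: metrizable_space_product_topology metrizable_space_euclidean)
  qed
  then obtain S d where S: "Metric_space S d"
      "subtopology (powertop_real D) (r ` K) = Metric_space.mtopology S d"
    unfolding metrizable_space_def by blast
  define M where "M = metric (S, d)"
  have M: "mtopology_of M = subtopology (powertop_real D) (r ` K)" "mspace M = S"
    using S by (simp_all add: M_def mtopology_of_def
        Metric_space.mspace_metric Metric_space.mdist_metric)
  have "r ` K \<subseteq> topspace (powertop_real D)"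
    using continuous_map_image_subset_topspace[OF cont] by (simp only: topT)
  then have rK: "r ` K = mspace M"
    by (simp only: M(1) topspace_subtopology_subset flip: topspace_mtopology_of)
  show ?thesis
  proof (rule Corson_to_one_preimage_of_metricI)
    show "continuous_map ?T (mtopology_of M) r"
      unfolding M(1) continuous_map_in_subtopology using cont by (simp only: topT) blast
    show "r ` topspace ?T = mspace M"
      by (simp only: topT rK)
    fix m assume m: "m \<in> mspace M"
    let ?F = "{x \<in> topspace ?T. r x = m}"
    have "Hausdorff_space (powertop_real D)"
      by (simp add: Hausdorff_space_product_topology)
    moreover have "m \<in> topspace (powertop_real D)"
      using m rK \<open>r ` K \<subseteq> _\<close> by blast
    ultimately have "closedin (powertop_real D) {m}"
      by (simp add: closedin_Hausdorff_singleton)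
    then have "closedin ?T ?F"
      using closedin_continuous_map_preimage[OF cont, of "{m}"] by (simp only: singleton_iff)
    moreover have "compact_space ?T"
      using K by (simp only: compactin_subspace)
    ultimately have "compactin ?T ?F"
      by (intro closedin_compact_space)
    then have cptF: "compactin (powertop_real I) ?F"
      by (simp only: compactin_subtopology)
    have FK: "K \<inter> ?F = ?F"
      unfolding topT by blast
    have cntF: "countable {i \<in> I. f i \<noteq> g i}" if "f \<in> ?F" "g \<in> ?F" for f g
    proof (rule cnt)
      show "f \<in> K" "g \<in> K" using that by (simp_all only: topT mem_Collect_eq)
      have "r f = r g" using that by (simp only: mem_Collect_eq)
      then show "f d = g d" if "d \<in> D" for d
        using that unfolding r_def by (metis restrict_apply')
    qed
    have "Corson_compact (subtopology (powertop_real I) ?F)"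
      by (rule Corson_compactI[OF cptF cntF homeomorphic_space_refl])
    then show "Corson_compact (subtopology ?T ?F)"
      by (simp only: subtopology_subtopology FK)
  qed
qed

theorem proposition3:
  fixes X :: "'a topology" and K :: "('a \<Rightarrow> real) set"
  assumes "completely_metrizable_space X" and "separable_space X"
    and "\<And>f. f \<in> K \<Longrightarrow> countable {x \<in> topspace X. \<not> topcontinuous_at X euclideanreal f x}"
    and "compactin (powertop_real (topspace X)) K"
  shows "Corson_to_one_preimage_of_metric (subtopology (powertop_real (topspace X)) K)"
proof -
  obtain D where D: "countable D" "D \<subseteq> topspace X" "X closure_of D = topspace X"
    using assms(2) unfolding separable_space_def by blast
  show ?thesis
  proof (rule Corson_to_one_preimage_of_metric_countable_coordinates[OF assms(4) D(1,2)])
    fix f g assume f: "f \<in> K" and g: "g \<in> K" and eq: "\<And>d. d \<in> D \<Longrightarrow> f d = g d"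
    let ?N = "\<lambda>h. {x \<in> topspace X. \<not> topcontinuous_at X euclideanreal h x}"
    have "f x = g x" if "x \<in> topspace X" "x \<notin> ?N f" "x \<notin> ?N g" for x
    proof -
      have "x \<in> X closure_of D"
        using that(1) D(3) by simp
      moreover have "topcontinuous_at X euclideanreal f x" "topcontinuous_at X euclideanreal g x"
        using that by simp_all
      ultimately show ?thesis
        by (rule topcontinuous_at_eq_in_closure_of[OF _ _ _ Hausdorff_space_euclidean eq])
    qed
    then have "{x \<in> topspace X. f x \<noteq> g x} \<subseteq> ?N f \<union> ?N g"
      by blast
    then show "countable {x \<in> topspace X. f x \<noteq> g x}"
      using assms(3) f g by (meson countable_Un countable_subset)
  qed
qed

end
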